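(* Let $G$ be a graph with vertices $v_1,\dots,v_n$ and let $\overline{G}$ be its complement. Then for every vertex $v_i$, $$\mathcal{E}_S(v_i;\overline{G})=\mathcal{E}_S(v_i;G).$$
   Context: All graphs are finite, simple and undirected. The complement $\overline{G}$ is the graph on the same vertex set in which two distinct vertices are adjacent if and only if they are non-adjacent in $G$. The Seidel matrix of a graph $G$ with vertex set $\{v_1,\dots,v_n\}$ is the real symmetric $n\times n$ matrix $S(G)=[s_{ij}]$ with $s_{ii}=0$, and for $i\neq j$, $s_{ij}=-1$ if $v_i$ and $v_j$ are adjacent and $s_{ij}=1$ otherwise. For a real symmetric matrix $S$, $|S|=(S^2)^{1/2}$ is the positive semidefinite square root of $S^2$. The vertex Seidel energy of $v_i$ in $G$ is $\mathcal{E}_S(v_i;G)=|S(G)|_{ii}$, the $i$-th diagonal entry of $|S(G)|$. *)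

theory Defs
  imports "HOL-Analysis.Analysis" "Graph_Theory.Pair_Digraph"
begin

section \<open>Positive semidefinite square roots\<close>

definition psd :: "real ^ 'n ^ 'n \<Rightarrow> bool" where
  "psd A \<longleftrightarrow> transpose A = A \<and> (\<forall>x. 0 \<le> x \<bullet> (A *v x))"

text \<open>The description is well-defined whenever \<open>A\<close> is positive semidefinite,
  see \<open>psd_sqrt_ex1\<close> below.\<close>

definition psd_sqrt :: "real ^ 'n ^ 'n \<Rightarrow> real ^ 'n ^ 'n" where
  "psd_sqrt A = (THE B. psd B \<and> B ** B = A)"

definition mat_abs :: "real ^ 'n ^ 'n \<Rightarrow> real ^ 'n ^ 'n" where
  "mat_abs S = psd_sqrt (S ** S)"

lemma sym_inner:
  fixes A :: "real ^ 'n ^ 'n"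
  assumes "transpose A = A"
  shows "x \<bullet> (A *v y) = (A *v x) \<bullet> y"
  by (metis assms dot_lmul_matrix transpose_matrix_vector)

lemma sym_eigenvector:
  fixes A :: "real ^ 'n ^ 'n"
  assumes sym: "transpose A = A" and V: "subspace V" and inv: "\<And>x. x \<in> V \<Longrightarrow> A *v x \<in> V"
    and ne: "V \<noteq> {0}"
  obtains u l where "u \<in> V" "norm u = 1" "A *v u = l *\<^sub>R u"
proof -
  obtain z where z: "z \<in> V" "z \<noteq> 0"
    using ne V subspace_0 by blast
  let ?K = "sphere 0 1 \<inter> V"
  have "(1 / norm z) *\<^sub>R z \<in> ?K"
    using z V by (auto simp: subspace_scale)
  then have "?K \<noteq> {}" by blast
  moreover have "compact ?K"
    using V by (intro compact_Int_closed closed_subspace) auto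
  moreover have "continuous_on ?K (\<lambda>x. x \<bullet> (A *v x))"
    by (intro continuous_intros linear_continuous_on)
       (simp add: bounded_linear_def linear_conv_bounded_linear[symmetric])
  ultimately obtain u where u: "u \<in> ?K" and max: "\<And>x. x \<in> ?K \<Longrightarrow> x \<bullet> (A *v x) \<le> u \<bullet> (A *v u)"
    using continuous_attains_sup[of ?K "\<lambda>x. x \<bullet> (A *v x)"] by blast
  define l where "l = u \<bullet> (A *v u)"
  define B where "B x = l *\<^sub>R x - A *v x" for x
  have uu: "u \<bullet> u = 1" "u \<in> V" "norm u = 1"
    using u by (auto simp: norm_eq_1)
  have Q: "0 \<le> x \<bullet> B x" if x: "x \<in> V" for x
  proof (cases "x = 0")
    case False
    let ?c = "1 / norm x"
    have "?c *\<^sub>R x \<in> ?K" using x V False by (auto simp: subspace_scale)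
    from max[OF this] have "?c * (?c * (x \<bullet> (A *v x))) \<le> l"
      by (simp add: l_def matrix_vector_mult_scaleR)
    then have "x \<bullet> (A *v x) \<le> l * (norm x)\<^sup>2"
      using False by (simp add: field_simps power2_eq_square)
    then show ?thesis by (simp add: B_def inner_diff_right power2_norm_eq_inner)
  qed (simp add: B_def)
  have symB: "x \<bullet> B y = y \<bullet> B x" for x y
    using sym_inner[OF sym, of x y] by (simp add: B_def inner_diff_right inner_commute)
  have Blin: "B (x + t *\<^sub>R y) = B x + t *\<^sub>R B y" for x y t
    by (simp add: B_def algebra_simps matrix_vector_right_distrib matrix_vector_mult_scaleR)
  have Bu0: "u \<bullet> B u = 0" using uu by (simp add: B_def inner_diff_right l_def)
  define w where "w = B u"
  have w: "w \<in> V" using uu V inv by (auto simp: w_def B_def intro!: subspace_diff subspace_scale)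
  have quad: "0 \<le> 2 * t * (w \<bullet> w) + t * t * (w \<bullet> B w)" for t
  proof -
    have "0 \<le> (u + t *\<^sub>R w) \<bullet> B (u + t *\<^sub>R w)"
      using uu w V by (intro Q subspace_add subspace_scale)
    also have "\<dots> = 2 * t * (w \<bullet> w) + t * t * (w \<bullet> B w)"
      using Bu0 symB[of u w] by (simp add: Blin inner_add_left inner_add_right algebra_simps w_def)
    finally show ?thesis .
  qed
  have "w \<bullet> w = 0"
  proof (rule ccontr)
    assume "w \<bullet> w \<noteq> 0"
    then have p: "w \<bullet> w > 0" by simp
    define q where "q = w \<bullet> B w"
    have q: "q \<ge> 0" using Q w by (simp add: q_def)
    define t where "t = - (w \<bullet> w) / (q + 1)"
    have t: "t * (q + 1) = - (w \<bullet> w)" using q by (simp add: t_def)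
    have "t < 0" using p q by (simp add: t_def divide_neg_pos)
    moreover have "2 * (w \<bullet> w) + t * q > 0"
    proof -
      have "t * q = - (w \<bullet> w) - t" using t by (simp add: algebra_simps)
      with p \<open>t < 0\<close> show ?thesis by linarith
    qed
    ultimately have "t * (2 * (w \<bullet> w) + t * q) < 0" by (rule mult_neg_pos)
    with quad[of t] show False by (simp add: q_def algebra_simps)
  qed
  then have "A *v u = l *\<^sub>R u" by (simp add: w_def B_def)
  with uu show ?thesis using that by blast
qed

lemma sym_orthonormal_eigenbasis_on:
  fixes A :: "real ^ 'n ^ 'n"
  assumes sym: "transpose A = A"
  shows "subspace V \<Longrightarrow> (\<And>x. x \<in> V \<Longrightarrow> A *v x \<in> V) \<Longrightarrow>
    \<exists>E\<subseteq>V. V \<subseteq> span E \<and> pairwise orthogonal E \<and> (\<forall>e\<in>E. norm e = 1 \<and> (\<exists>l. A *v e = l *\<^sub>R e))"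
proof (induction "dim V" arbitrary: V rule: less_induct)
  case less
  show ?case
  proof (cases "V = {0}")
    case True
    then show ?thesis by (intro exI[of _ "{}"]) auto
  next
    case False
    obtain u l where u: "u \<in> V" "norm u = 1" "A *v u = l *\<^sub>R u"
      using sym_eigenvector[OF sym less.prems False] by metis
    have uu: "u \<bullet> u = 1" using u by (simp add: norm_eq_1)
    define W where "W = {x \<in> V. u \<bullet> x = 0}"
    have W: "subspace W"
      using less.prems(1) by (auto simp: W_def subspace_def inner_add_right)
    have "u \<notin> W" using uu by (simp add: W_def)
    moreover have "W \<subseteq> V" by (auto simp: W_def)
    ultimately have "W \<subset> V" using u by blast
    then have "dim W < dim V"
      using W less.prems(1) dim_psubset[of W V] by (simp add: span_eq_iff[THEN iffD2])
    moreover have "A *v x \<in> W" if "x \<in> W" for x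
      using that less.prems(2) sym_inner[OF sym, of u x] u(3) by (auto simp: W_def)
    ultimately obtain E where E: "E \<subseteq> W" "W \<subseteq> span E" "pairwise orthogonal E"
      "\<forall>e\<in>E. norm e = 1 \<and> (\<exists>l. A *v e = l *\<^sub>R e)"
      using less.hyps[OF _ W] by metis
    have "x \<in> span (insert u E)" if x: "x \<in> V" for x
    proof -
      have "x - (u \<bullet> x) *\<^sub>R u \<in> W"
        using x u less.prems(1) uu by (auto simp: W_def inner_diff_right intro!: subspace_diff subspace_scale)
      then have "x - (u \<bullet> x) *\<^sub>R u \<in> span E" using E by blast
      then show ?thesis using span_breakdown_eq by blast
    qed
    moreover have "pairwise orthogonal (insert u E)"
      using E(1,3) by (auto simp: pairwise_insert orthogonal_def W_def inner_commute)
    moreover have "insert u E \<subseteq> V" using u E \<open>W \<subset> V\<close> by blast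
    ultimately show ?thesis using u E(4) by (intro exI[of _ "insert u E"]) blast
  qed
qed

lemma psd_eigenbasis:
  fixes A :: "real ^ 'n ^ 'n"
  assumes "psd A"
  obtains E l where "span E = UNIV" "finite E"
    "\<And>e f. e \<in> E \<Longrightarrow> f \<in> E \<Longrightarrow> e \<bullet> f = (if e = f then 1 else 0)"
    "\<And>e. e \<in> E \<Longrightarrow> A *v e = l e *\<^sub>R e" "\<And>e. e \<in> E \<Longrightarrow> 0 \<le> l e"
proof -
  have sym: "transpose A = A" using assms by (simp add: psd_def)
  obtain E where E: "UNIV \<subseteq> span E" "pairwise orthogonal E"
    "\<forall>e\<in>E. norm e = 1 \<and> (\<exists>l. A *v e = l *\<^sub>R e)"
    using sym_orthonormal_eigenbasis_on[OF sym, of UNIV] by auto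
  have on: "e \<bullet> f = (if e = f then 1 else 0)" if "e \<in> E" "f \<in> E" for e f
    using that E by (auto simp: pairwise_def orthogonal_def norm_eq_1)
  have ev: "A *v e = (e \<bullet> (A *v e)) *\<^sub>R e" if "e \<in> E" for e
    using that E on[OF that that] by auto
  have "finite E" using E(2) pairwise_orthogonal_imp_finite by blast
  then show ?thesis
    using that[of E "\<lambda>e. e \<bullet> (A *v e)"] E(1) on ev assms by (auto simp: psd_def)
qed

lemma psd_sqrt_ex1:
  fixes A :: "real ^ 'n ^ 'n"
  assumes "psd A"
  shows "\<exists>!B. psd B \<and> B ** B = A"
proof -
  obtain E l where span: "span E = UNIV" and fin: "finite E"
    and on: "\<And>e f. e \<in> E \<Longrightarrow> f \<in> E \<Longrightarrow> e \<bullet> f = (if e = f then 1 else 0)"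
    and ev: "\<And>e. e \<in> E \<Longrightarrow> A *v e = l e *\<^sub>R e" and pos: "\<And>e. e \<in> E \<Longrightarrow> 0 \<le> l e"
    using psd_eigenbasis[OF assms] by metis
  have eqI: "M = N" if "\<And>e. e \<in> E \<Longrightarrow> M *v e = N *v e" for M N :: "real ^ 'n ^ 'n"
  proof -
    have "M *v x = N *v x" for x
      using linear_eq_on_span[of "(*v) M" "(*v) N" E x] that span by auto
    then show ?thesis by (simp add: matrix_eq)
  qed
  define g where "g x = (\<Sum>e\<in>E. (sqrt (l e) * (e \<bullet> x)) *\<^sub>R e)" for x
  have "linear g"
    by (rule linearI)
       (simp_all add: g_def inner_add_right algebra_simps sum.distrib scaleR_sum_right)
  then have B: "matrix g *v x = g x" for x by (simp add: matrix_works)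
  have gin: "x \<bullet> g y = (\<Sum>e\<in>E. sqrt (l e) * (e \<bullet> x) * (e \<bullet> y))" for x y
    by (simp add: g_def inner_sum_right inner_commute algebra_simps)
  have "transpose (matrix g) = matrix g"
  proof -
    have "matrix g $ i $ j = matrix g $ j $ i" for i j
    proof -
      have "matrix g $ i $ j = axis i 1 \<bullet> g (axis j 1)" for i j
        by (simp add: matrix_def inner_axis' )
      then show ?thesis by (simp add: gin algebra_simps)
    qed
    then show ?thesis by (simp add: transpose_def vec_eq_iff)
  qed
  moreover have "0 \<le> x \<bullet> g x" for x
    unfolding gin using pos by (intro sum_nonneg) (simp add: mult.assoc)
  ultimately have psdB: "psd (matrix g)" by (simp add: psd_def B)
  have ge: "g e = sqrt (l e) *\<^sub>R e" if "e \<in> E" for e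
  proof -
    have "g e = (\<Sum>f\<in>E. if f = e then sqrt (l e) *\<^sub>R e else 0)"
      unfolding g_def using that on by (intro sum.cong) auto
    then show ?thesis using that fin by simp
  qed
  have sq: "matrix g ** matrix g = A"
  proof (rule eqI)
    fix e assume e: "e \<in> E"
    have "g (g e) = sqrt (l e) *\<^sub>R g e"
      using linear_scale[OF \<open>linear g\<close>] by (simp add: ge[OF e])
    then show "(matrix g ** matrix g) *v e = A *v e"
      using e pos by (simp add: matrix_vector_mul_assoc[symmetric] B ge ev)
  qed
  have uniq: "C *v e = sqrt (l e) *\<^sub>R e" if C: "psd C" "C ** C = A" and e: "e \<in> E" for C e
  proof -
    have sym: "transpose C = C" using C by (simp add: psd_def)
    define s where "s = sqrt (l e)"
    have s: "s \<ge> 0" "l e = s * s" using pos e by (auto simp: s_def)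
    have CC: "C *v (C *v e) = (s * s) *\<^sub>R e"
      using ev[OF e] C s by (simp add: matrix_vector_mul_assoc)
    show ?thesis
    proof (cases "s = 0")
      case True
      then have "(C *v e) \<bullet> (C *v e) = 0"
        using CC sym_inner[OF sym, of e "C *v e"] by simp
      then show ?thesis using True by (simp add: s_def)
    next
      case False
      define w where "w = C *v e - s *\<^sub>R e"
      have "C *v w = - s *\<^sub>R w"
        by (simp add: w_def matrix_vector_mult_diff_distrib matrix_vector_mult_scaleR CC algebra_simps)
      moreover have "0 \<le> w \<bullet> (C *v w)" using C by (simp add: psd_def)
      ultimately have "s * (w \<bullet> w) \<le> 0" by simp
      then have "w \<bullet> w \<le> 0" using s False by (simp add: mult_le_0_iff)
      then have "w = 0" by (metis inner_eq_zero_iff inner_ge_zero order_antisym)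
      then show ?thesis by (simp add: w_def s_def)
    qed
  qed
  show ?thesis
  proof (rule ex1I)
    show "psd (matrix g) \<and> matrix g ** matrix g = A" using psdB sq by blast
    fix C assume "psd C \<and> C ** C = A"
    then show "C = matrix g" using uniq ge by (intro eqI) (simp add: B)
  qed
qed

lemma psd_square:
  fixes S :: "real ^ 'n ^ 'n"
  assumes "transpose S = S"
  shows "psd (S ** S)"
proof -
  have "x \<bullet> (S *v (S *v x)) = (S *v x) \<bullet> (S *v x)" for x
    by (rule sym_inner[OF assms])
  then show ?thesis
    using assms inner_ge_zero
    by (metis psd_def matrix_transpose_mul matrix_vector_mul_assoc)
qed

lemma mat_abs_char:
  fixes S :: "real ^ 'n ^ 'n"
  assumes "transpose S = S"
  shows "psd (mat_abs S)" "mat_abs S ** mat_abs S = S ** S"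
  using theI'[OF psd_sqrt_ex1[OF psd_square[OF assms]]]
  by (simp_all add: mat_abs_def psd_sqrt_def)


section \<open>Seidel matrix and vertex Seidel energy\<close>

text \<open>Finite simple undirected graphs are the \<^locale>\<open>pair_graph\<close>s: an edge between
  \<open>u\<close> and \<open>w\<close> is represented by the two arcs \<open>(u, w)\<close> and \<open>(w, u)\<close>.\<close>

definition graph_complement :: "'a pair_pre_digraph \<Rightarrow> 'a pair_pre_digraph" where
  "graph_complement G = \<lparr> pverts = pverts G,
     parcs = {(u, w). u \<in> pverts G \<and> w \<in> pverts G \<and> u \<noteq> w \<and> (u, w) \<notin> parcs G} \<rparr>"

text \<open>The vertices are listed by a bijection \<open>v\<close> from a finite index type onto
  \<open>pverts G\<close>; the number of vertices is the cardinality of that type.\<close>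

definition seidel_matrix :: "'a pair_pre_digraph \<Rightarrow> ('n \<Rightarrow> 'a) \<Rightarrow> real ^ 'n ^ 'n" where
  "seidel_matrix G v =
     (\<chi> i j. if i = j then 0 else if (v i, v j) \<in> parcs G then - 1 else 1)"

definition vertex_seidel_energy :: "'a pair_pre_digraph \<Rightarrow> ('n::finite \<Rightarrow> 'a) \<Rightarrow> 'n \<Rightarrow> real" where
  "vertex_seidel_energy G v i = mat_abs (seidel_matrix G v) $ i $ i"

lemma pair_graph_complement:
  assumes "pair_graph G"
  shows "pair_graph (graph_complement G)"
proof -
  interpret pair_graph G by fact
  have "finite (pverts G \<times> pverts G)" by simp
  then have "finite (parcs (graph_complement G))"
    by (rule finite_subset[rotated]) (auto simp: graph_complement_def)
  moreover have "(w, u) \<in> parcs G" if "(u, w) \<in> parcs G" for u w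
    using that pair_sym_arcs by (auto simp: symmetric_def sym_def)
  ultimately show ?thesis
    by unfold_locales (auto simp: graph_complement_def symmetric_def sym_def)
qed

lemma seidel_matrix_symmetric:
  assumes "pair_graph G"
  shows "transpose (seidel_matrix G v) = seidel_matrix G v"
proof -
  interpret pair_graph G by fact
  have "(w, u) \<in> parcs G" if "(u, w) \<in> parcs G" for u w
    using that pair_sym_arcs by (auto simp: symmetric_def sym_def)
  then show ?thesis by (auto simp: seidel_matrix_def transpose_def vec_eq_iff)
qed

end

theory Submission
  imports Defs
begin

text \<open>Passing to the complement swaps adjacency and non-adjacency, which flips the sign of
  every off-diagonal Seidel entry; the diagonal is zero. So the Seidel matrix is negated
  (\<open>seidel_matrix_complement\<close>). Since |S| depends on S only through its square, it is
  blind to this sign (\<open>mat_abs_minus\<close>), and so are its diagonal entries.\<close>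

lemma seidel_matrix_complement:
  assumes "inj v" and "range v \<subseteq> pverts G"
  shows "seidel_matrix (graph_complement G) v = - seidel_matrix G v"
proof -
  \<comment> \<open>These settle the side conditions on arcs in \<open>graph_complement\<close>: for
    distinct indices, exactly one of the two graphs has the arc \<open>(v i, v j)\<close>.\<close>
  have "v i \<in> pverts G" "v i = v j \<longleftrightarrow> i = j" for i j
    using assms by (auto dest: injD)
  then show ?thesis
    by (simp add: seidel_matrix_def graph_complement_def vec_eq_iff)
qed

lemma mat_abs_minus: "mat_abs (- S) = mat_abs S"
proof -
  \<comment> \<open>The signs cancel in each product of entries, so \<open>psd_sqrt\<close> receives
    the same matrix on both sides.\<close>
  have "(- S) ** (- S) = S ** S"
    by (simp add: matrix_matrix_mult_def)
  then show ?thesis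
    by (simp add: mat_abs_def)
qed

theorem theorem7:
  fixes G :: "'a pair_pre_digraph" and v :: "'n::finite \<Rightarrow> 'a"
  assumes "pair_graph G" and "bij_betw v UNIV (pverts G)"
  shows "\<forall>i. vertex_seidel_energy (graph_complement G) v i = vertex_seidel_energy G v i"
proof -
  have "seidel_matrix (graph_complement G) v = - seidel_matrix G v"
    using assms(2) by (intro seidel_matrix_complement) (simp_all add: bij_betw_def)
  then show ?thesis
    by (simp add: vertex_seidel_energy_def mat_abs_minus)
qed

end
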